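(* Let $\Omega\subset\mathbb{R}^d$ be an open set and let $K:\Omega\times\Omega\to\mathbb{C}$ be a (measurable) translation-invariant positive-definite kernel. Then the map $$(\varphi,\psi)\;\longmapsto\;\langle F_\varphi,F_\psi\rangle := \int_\Omega\int_\Omega K(\theta,\theta')\,\varphi(\theta)\,\overline{\psi(\theta')}\,d\theta\,d\theta',\qquad \varphi,\psi\in C_0^\infty(\Omega),$$ is itself a positive-definite kernel on $C_0^\infty(\Omega)$.
   Context: $C_0^\infty(\Omega)$ denotes the smooth compactly supported complex-valued functions on $\Omega$. A kernel $K:S\times S\to\mathbb{C}$ on a set $S$ is called positive-definite if for every $m\in\mathbb{N}$, all $s_1,\dots,s_m\in S$ and all $c_1,\dots,c_m\in\mathbb{C}$ one has $\sum_{j,k=1}^m c_j\overline{c_k}\,K(s_j,s_k)\ge 0$ (non-strict inequality; in particular the sum is real). A kernel $K$ on $\Omega$ is translation-invariant if $K(x,y)$ depends only on $x-y$, i.e. there is a function $F:\Omega-\Omega\to\mathbb{C}$, where $\Omega-\Omega=\{x-y:x,y\in\Omega\}$, with $K(x,y)=F(x-y)$ for all $x,y\in\Omega$. For $\varphi\in C_0^\infty(\Omega)$, $F_\varphi=\int_\Omega K(\cdot,\theta)\varphi(\theta)\,d\theta$ is the kernel mean embedding of $\varphi$ under $K$; the inner product of two kernel mean embeddings is the double integral displayed in the claim. *)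

theory Defs
  imports "HOL-Analysis.Analysis"
begin

primrec Ck_on ::
  "nat \<Rightarrow> 'a::real_normed_vector set \<Rightarrow> ('a \<Rightarrow> 'b::real_normed_vector) \<Rightarrow> bool" where
  "Ck_on 0 S f \<longleftrightarrow> continuous_on S f"
| "Ck_on (Suc k) S f \<longleftrightarrow> (\<forall>x\<in>S. f differentiable (at x)) \<and>
     (\<forall>v. Ck_on k S (\<lambda>x. frechet_derivative f (at x) v))"

definition smooth_on :: "'a::real_normed_vector set \<Rightarrow> ('a \<Rightarrow> 'b::real_normed_vector) \<Rightarrow> bool" where
  "smooth_on S f \<longleftrightarrow> (\<forall>k. Ck_on k S f)"

text \<open>Elements of \<open>C\<^sub>0\<^sup>\<infinity>(\<Omega>)\<close> are represented by their extensions by zero, so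
  that distinct functions on \<open>\<Omega>\<close> correspond to distinct HOL functions and conversely.\<close>

definition test_functions :: "'a::euclidean_space set \<Rightarrow> ('a \<Rightarrow> complex) set" where
  "test_functions \<Omega> = {\<phi>. smooth_on \<Omega> \<phi> \<and>
     compact (closure {x. \<phi> x \<noteq> 0}) \<and> closure {x. \<phi> x \<noteq> 0} \<subseteq> \<Omega>}"

definition positive_definite_kernel :: "'s set \<Rightarrow> ('s \<Rightarrow> 's \<Rightarrow> complex) \<Rightarrow> bool" where
  "positive_definite_kernel S K \<longleftrightarrow>
     (\<forall>(m::nat) (s :: nat \<Rightarrow> 's) (c :: nat \<Rightarrow> complex). (\<forall>j\<in>{1..m}. s j \<in> S) \<longrightarrow>
        (\<Sum>j=1..m. \<Sum>k=1..m. c j * cnj (c k) * K (s j) (s k)) \<in> \<real>\<^sub>\<ge>\<^sub>0)"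

text \<open>Only the values of \<open>F\<close> on \<open>\<Omega> - \<Omega>\<close> matter.\<close>

definition translation_invariant_kernel :: "'a::minus set \<Rightarrow> ('a \<Rightarrow> 'a \<Rightarrow> complex) \<Rightarrow> bool" where
  "translation_invariant_kernel \<Omega> K \<longleftrightarrow> (\<exists>F. \<forall>x\<in>\<Omega>. \<forall>y\<in>\<Omega>. K x y = F (x - y))"

text \<open>Lebesgue measurability on the product, which Borel measurable kernels satisfy in particular.\<close>

definition measurable_kernel :: "'a::euclidean_space set \<Rightarrow> ('a \<Rightarrow> 'a \<Rightarrow> complex) \<Rightarrow> bool" where
  "measurable_kernel \<Omega> K \<longleftrightarrow> (\<lambda>(x, y). K x y) \<in> borel_measurable (lebesgue_on (\<Omega> \<times> \<Omega>))"

text \<open>The inner product \<open>\<langle>F\<^sub>\<phi>, F\<^sub>\<psi>\<rangle>\<close> of the kernel mean embeddings of \<open>\<phi>\<close> and \<open>\<psi>\<close>.\<close>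

definition mean_embedding_inner ::
  "'a::euclidean_space set \<Rightarrow> ('a \<Rightarrow> 'a \<Rightarrow> complex) \<Rightarrow> ('a \<Rightarrow> complex) \<Rightarrow> ('a \<Rightarrow> complex) \<Rightarrow> complex"
where
  "mean_embedding_inner \<Omega> K \<phi> \<psi> =
     (LINT \<theta>':\<Omega>|lebesgue. LINT \<theta>:\<Omega>|lebesgue. K \<theta> \<theta>' * \<phi> \<theta> * cnj (\<psi> \<theta>'))"

end

theory Submission
  imports Defs "HOL-Probability.Infinite_Product_Measure"
begin

text \<open>
  By linearity, the claim is that \<open>I = \<integral>\<integral> K(x, y) \<Phi>(x) \<Phi>(y)\<^sup>* dx dy\<close> (with \<open>*\<close> for complex
  conjugation) is a nonnegative real for every finite linear combination \<open>\<Phi>\<close> of test functions.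
  As \<open>K\<close> is only measurable, this integral cannot be approached by Riemann sums over grids of
  points; random points are used instead.  Draw \<open>n\<close> independent points \<open>\<omega>\<^sub>1, \<dots>, \<omega>\<^sub>n\<close>, uniformly from a
  ball that contains the support of \<open>\<Phi>\<close>.  The kernel \<open>H(x, y) = \<Phi>(x) \<Phi>(y)\<^sup>* K(x, y)\<close> is again
  positive-definite, so \<open>\<Sum>\<^sub>j\<^sub>,\<^sub>k H(\<omega>\<^sub>j, \<omega>\<^sub>k) \<ge> 0\<close> for every sample.  In expectation, the \<open>n(n - 1)\<close>
  off-diagonal terms contribute \<open>n(n - 1) I\<close> up to a positive factor that does not depend on \<open>n\<close>,
  while the \<open>n\<close> diagonal terms contribute at most \<open>n C\<close> for a bound \<open>C\<close> of \<open>H(x, x)\<close>.  Dividing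
  by \<open>n(n - 1)\<close> and letting \<open>n\<close> grow gives \<open>I \<ge> 0\<close>.  This is
  \<open>double_integral_positive_definite_nonneg_prob\<close> for a probability measure and
  \<open>double_integral_positive_definite_nonneg\<close> for a sigma-finite one.

  Translation invariance enters only through \<open>K(x, x) = F(0)\<close>: together with the positivity of the
  \<open>2 \<times> 2\<close> matrices of a positive-definite kernel it makes \<open>K\<close> bounded
  (\<open>positive_definite_kernel_norm_le\<close>), and then all the integrals converge absolutely.

  The kernel is Lebesgue measurable on the product, hence in general not measurable for the product
  of the two sigma-algebras.  It is therefore replaced by a Borel function \<open>G\<close> that agrees with it
  almost everywhere; \<open>mean_embedding_inner_eq_integral_prod\<close> shows that the iterated integral does
  not see the change.  The diagonal is a null set, on which \<open>G\<close> says nothing about \<open>K\<close>; this is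
  why the sampling argument separates the diagonal terms and bounds them pointwise by means of \<open>K\<close>.
\<close>

section \<open>Positive-definite kernels\<close>

lemma positive_definite_kernelD:
  fixes m :: nat
  assumes "positive_definite_kernel S K" "\<And>j. j \<in> {1..m} \<Longrightarrow> s j \<in> S"
  shows "(\<Sum>j=1..m. \<Sum>k=1..m. c j * cnj (c k) * K (s j) (s k)) \<in> \<real>\<^sub>\<ge>\<^sub>0"
  using assms(1)[unfolded positive_definite_kernel_def, rule_format, of m s c] assms(2) by blast

lemma positive_definite_kernel_diag:
  assumes "positive_definite_kernel S K" "x \<in> S"
  shows "K x x \<in> \<real>\<^sub>\<ge>\<^sub>0"
  using positive_definite_kernelD[OF assms(1), of 1 "\<lambda>_. x" "\<lambda>_. 1"] assms(2)
  by (simp del: sum_constant)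

text \<open>This is positivity of the \<open>2 \<times> 2\<close> matrix of \<open>K\<close> at \<open>x, y\<close>, tested on the vector \<open>(1, z)\<close>
  with the \<open>z\<close> that turns both off-diagonal terms into \<open>- \<bar>K(x, y)\<bar>\<close>; it is unimodular if
  \<open>K(x, y)\<close> is nonzero, and zero otherwise.\<close>

lemma positive_definite_kernel_norm_le:
  assumes pd: "positive_definite_kernel S K" and x: "x \<in> S" and y: "y \<in> S"
  shows "norm (K x y) \<le> (Re (K x x) + Re (K y y)) / 2"
proof -
  have two: "K x x + cnj z * K x y + z * K y x + z * cnj z * K y y \<in> \<real>\<^sub>\<ge>\<^sub>0" for z
  proof -
    have "{1..2::nat} = {1,2}" by auto
    then show ?thesis
      using positive_definite_kernelD[OF pd, of 2 "\<lambda>j. if j = 1 then x else y" "\<lambda>j. if j = 1 then 1 else z"] x y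
      by (simp add: algebra_simps)
  qed
  have dx: "Im (K x x) = 0" and dy: "Im (K y y) = 0"
    using positive_definite_kernel_diag[OF pd x] positive_definite_kernel_diag[OF pd y]
    by (auto simp: complex_nonneg_Reals_iff)
  \<comment> \<open>the sum in \<open>two\<close> is real; \<open>z = 1\<close> and \<open>z = \<i>\<close> then give the two halves of Hermitian symmetry\<close>
  have herm: "K y x = cnj (K x y)"
    using two[of 1] two[of \<i>] dx dy
    by (auto simp: complex_nonneg_Reals_iff complex_eq_iff)
  define z where "z = - sgn (K x y)"
  have zk: "cnj z * K x y = - of_real (norm (K x y))"
    using complex_norm_square[of "K x y"]
    by (cases "K x y = 0") (auto simp: z_def sgn_eq field_simps power2_eq_square)
  have "z * K y x = cnj (cnj z * K x y)" by (simp add: herm)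
  then have zk': "z * K y x = - of_real (norm (K x y))"
    by (simp add: zk)
  have zz: "z * cnj z = of_bool (K x y \<noteq> 0)"
    by (subst complex_norm_square[symmetric]) (simp add: z_def norm_sgn)
  have "0 \<le> Re (K y y)"
    using positive_definite_kernel_diag[OF pd y] by (simp add: complex_nonneg_Reals_iff)
  moreover have "0 \<le> Re (K x x) - 2 * norm (K x y) + of_bool (K x y \<noteq> 0) * Re (K y y)"
    using two[of z] by (cases "K x y = 0") (simp_all add: zk zk' zz complex_nonneg_Reals_iff)
  ultimately show ?thesis by (cases "K x y = 0") auto
qed

text \<open>Points outside \<open>S\<close> drop out of the sum, so they may be moved to an arbitrary point of \<open>S\<close>
  and given the coefficient zero.\<close>

lemma positive_definite_kernel_zero_extension:
  assumes pd: "positive_definite_kernel S K"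
  shows "positive_definite_kernel UNIV (\<lambda>x y. if x \<in> S \<and> y \<in> S then K x y else 0)"
proof (cases "S = {}")
  case False
  then obtain a where a: "a \<in> S" by blast
  show ?thesis
    unfolding positive_definite_kernel_def
  proof (intro allI impI)
    fix m :: nat and s c
    show "(\<Sum>j = 1..m. \<Sum>k = 1..m. c j * cnj (c k) * (if s j \<in> S \<and> s k \<in> S then K (s j) (s k) else 0)) \<in> \<real>\<^sub>\<ge>\<^sub>0"
      (is "?l \<in> _")
    proof -
      have "?l = (\<Sum>j = 1..m. \<Sum>k = 1..m. (if s j \<in> S then c j else 0) * cnj (if s k \<in> S then c k else 0) *
          K (if s j \<in> S then s j else a) (if s k \<in> S then s k else a))"
        by (intro sum.cong refl) auto
      also have "\<dots> \<in> \<real>\<^sub>\<ge>\<^sub>0"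
        using a by (intro positive_definite_kernelD[OF pd]) auto
      finally show ?thesis .
    qed
  qed
qed (simp add: positive_definite_kernel_def)

text \<open>The weights are absorbed into the coefficients.\<close>

lemma positive_definite_kernel_weighted:
  assumes pd: "positive_definite_kernel S K"
  shows "positive_definite_kernel S (\<lambda>x y. g x * cnj (g y) * K x y)"
  unfolding positive_definite_kernel_def
proof (intro allI impI)
  fix m :: nat and s c
  assume "\<forall>j\<in>{1..m}. s j \<in> S"
  then show "(\<Sum>j = 1..m. \<Sum>k = 1..m. c j * cnj (c k) * (g (s j) * cnj (g (s k)) * K (s j) (s k))) \<in> \<real>\<^sub>\<ge>\<^sub>0"
    using positive_definite_kernelD[OF pd, of m s "\<lambda>j. c j * g (s j)"]
    by (simp add: mult.assoc mult.left_commute)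
qed

section \<open>Double integrals of positive-definite kernels\<close>

text \<open>Two distinct coordinates of a product of copies of \<open>M\<close> are independent, each with law \<open>M\<close>.\<close>

lemma distr_PiM_pair:
  assumes M: "prob_space M" and jk: "j \<in> I" "k \<in> I" "j \<noteq> k"
  shows "distr (\<Pi>\<^sub>M i\<in>I. M) (M \<Otimes>\<^sub>M M) (\<lambda>\<omega>. (\<omega> j, \<omega> k)) = M \<Otimes>\<^sub>M M"
proof (rule sym, rule pair_measure_eqI)
  interpret prob_space M by fact
  show "sigma_finite_measure M" "sigma_finite_measure M" by unfold_locales
  show "sets (M \<Otimes>\<^sub>M M) = sets (distr (\<Pi>\<^sub>M i\<in>I. M) (M \<Otimes>\<^sub>M M) (\<lambda>\<omega>. (\<omega> j, \<omega> k)))" by simp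
  fix A B assume AB: "A \<in> sets M" "B \<in> sets M"
  have meas: "(\<lambda>\<omega>. (\<omega> j, \<omega> k)) \<in> (\<Pi>\<^sub>M i\<in>I. M) \<rightarrow>\<^sub>M M \<Otimes>\<^sub>M M"
    using jk by measurable
  have "(\<lambda>\<omega>. (\<omega> j, \<omega> k)) -` (A \<times> B) \<inter> space (\<Pi>\<^sub>M i\<in>I. M)
      = prod_emb I (\<lambda>_. M) {j, k} (\<Pi>\<^sub>E i\<in>{j, k}. if i = j then A else B)"
    using jk by (auto simp: prod_emb_def space_PiM PiE_iff)
  then show "emeasure M A * emeasure M B
      = emeasure (distr (\<Pi>\<^sub>M i\<in>I. M) (M \<Otimes>\<^sub>M M) (\<lambda>\<omega>. (\<omega> j, \<omega> k))) (A \<times> B)"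
    using jk AB M meas by (simp add: emeasure_distr emeasure_PiM_emb)
qed

text \<open>The sampling argument.  The integrated function \<open>G\<close> need only agree almost everywhere with the
  kernel \<open>H\<close>, since two distinct sample points form a pair with law \<open>M \<Otimes> M\<close>.  A repeated sample
  point does not, so the diagonal terms are bounded through \<open>H\<close> itself.\<close>

lemma double_integral_positive_definite_nonneg_prob:
  assumes M: "prob_space M"
    and pd: "positive_definite_kernel (space M) H"
    and diag: "\<And>x. x \<in> space M \<Longrightarrow> Re (H x x) \<le> C"
    and G [measurable]: "G \<in> borel_measurable (M \<Otimes>\<^sub>M M)"
    and ae: "AE p in M \<Otimes>\<^sub>M M. G p = H (fst p) (snd p)"
  shows "(LINT p|(M \<Otimes>\<^sub>M M). G p) \<in> \<real>\<^sub>\<ge>\<^sub>0"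
proof (cases "integrable (M \<Otimes>\<^sub>M M) G")
  case int: True
  note One_nat_def [simp del]
  define I where "I = (LINT p|(M \<Otimes>\<^sub>M M). G p)"
  have step: "Im (of_nat (n * (n - 1)) * I) = 0 \<and> - (of_nat n * C) \<le> Re (of_nat (n * (n - 1)) * I)" for n :: nat
  proof -
    let ?P = "\<Pi>\<^sub>M i\<in>{1..n}. M"
    interpret P: prob_space ?P by (intro prob_space_PiM M)
    \<comment> \<open>\<open>T\<close> is the off-diagonal part of the double sum over the sample \<open>\<omega>\<close>\<close>
    define D where "D = {p \<in> {1..n} \<times> {1..n}. fst p \<noteq> snd p}"
    define T where "T \<omega> = (\<Sum>(j,k)\<in>D. G (\<omega> j, \<omega> k))" for \<omega>
    have meas [measurable]: "(\<lambda>\<omega>. (\<omega> j, \<omega> k)) \<in> ?P \<rightarrow>\<^sub>M M \<Otimes>\<^sub>M M" if "(j, k) \<in> D" for j k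
      using that by (intro measurable_Pair measurable_component_singleton) (auto simp: D_def)
    have fin: "finite D" by (simp add: D_def)
    have distr: "distr ?P (M \<Otimes>\<^sub>M M) (\<lambda>\<omega>. (\<omega> j, \<omega> k)) = M \<Otimes>\<^sub>M M" if "(j, k) \<in> D" for j k
      using that by (intro distr_PiM_pair M) (auto simp: D_def)
    have intjk: "integrable ?P (\<lambda>\<omega>. G (\<omega> j, \<omega> k))" and Ijk: "(LINT \<omega>|?P. G (\<omega> j, \<omega> k)) = I"
      if "(j, k) \<in> D" for j k
    proof -
      show "integrable ?P (\<lambda>\<omega>. G (\<omega> j, \<omega> k))"
        using integrable_distr[OF meas[OF that], of G] int
        unfolding distr[OF that] by blast
      show "(LINT \<omega>|?P. G (\<omega> j, \<omega> k)) = I"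
        using integral_distr[OF meas[OF that] G] unfolding distr[OF that] I_def by simp
    qed
    have intT: "integrable ?P T"
      unfolding T_def by (intro Bochner_Integration.integrable_sum) (auto intro: intjk)
    have "D = {1..n} \<times> {1..n} - (\<lambda>j. (j, j)) ` {1..n}" by (auto simp: D_def)
    then have "card D = n * n - n"
      by (simp, subst card_Diff_subset) (auto simp: card_cartesian_product card_image inj_on_def)
    then have card: "card D = n * (n - 1)" by (simp add: diff_mult_distrib2)
    have "(LINT \<omega>|?P. T \<omega>) = (\<Sum>(j,k)\<in>D. LINT \<omega>|?P. G (\<omega> j, \<omega> k))"
      unfolding T_def by (subst Bochner_Integration.integral_sum) (auto intro: intjk simp: case_prod_unfold)
    also have "\<dots> = (\<Sum>p\<in>D. I)" by (intro sum.cong refl) (auto simp: Ijk)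
    finally have IT: "(LINT \<omega>|?P. T \<omega>) = of_nat (n * (n - 1)) * I" by (simp add: card)
    have "AE \<omega> in ?P. \<forall>p\<in>D. G (\<omega> (fst p), \<omega> (snd p)) = H (\<omega> (fst p)) (\<omega> (snd p))"
    proof (intro AE_finite_allI fin)
      fix p assume "p \<in> D"
      then have p: "(fst p, snd p) \<in> D" by simp
      have "AE q in distr ?P (M \<Otimes>\<^sub>M M) (\<lambda>\<omega>. (\<omega> (fst p), \<omega> (snd p))). G q = H (fst q) (snd q)"
        unfolding distr[OF p] by (rule ae)
      from AE_distrD[OF meas[OF p] this]
      show "AE \<omega> in ?P. G (\<omega> (fst p), \<omega> (snd p)) = H (\<omega> (fst p)) (\<omega> (snd p))"
        by simp
    qed
    then have "AE \<omega> in ?P. Im (T \<omega>) = 0 \<and> - (of_nat n * C) \<le> Re (T \<omega>)"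
      using AE_space
    proof eventually_elim
      case (elim \<omega>)
      have sp: "\<omega> j \<in> space M" if "j \<in> {1..n}" for j
        using elim(2) that by (auto simp: space_PiM)
      let ?d = "\<Sum>j=1..n. H (\<omega> j) (\<omega> j)"
      have "(\<Sum>j=1..n. \<Sum>k=1..n. H (\<omega> j) (\<omega> k)) = (\<Sum>(j,k)\<in>{1..n} \<times> {1..n}. H (\<omega> j) (\<omega> k))"
        by (simp add: sum.cartesian_product)
      also have "\<dots> = (\<Sum>(j,k)\<in>D \<union> (\<lambda>j. (j, j)) ` {1..n}. H (\<omega> j) (\<omega> k))"
        by (intro sum.cong refl) (auto simp: D_def)
      also have "\<dots> = (\<Sum>(j,k)\<in>D. H (\<omega> j) (\<omega> k)) + (\<Sum>(j,k)\<in>(\<lambda>j. (j, j)) ` {1..n}. H (\<omega> j) (\<omega> k))"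
        using fin by (intro sum.union_disjoint) (auto simp: D_def)
      also have "(\<Sum>(j,k)\<in>D. H (\<omega> j) (\<omega> k)) = T \<omega>"
        unfolding T_def using elim(1) by (intro sum.cong refl) auto
      also have "(\<Sum>(j,k)\<in>(\<lambda>j. (j, j)) ` {1..n}. H (\<omega> j) (\<omega> k)) = ?d"
        by (subst sum.reindex) (auto simp: inj_on_def)
      finally have eq: "(\<Sum>j=1..n. \<Sum>k=1..n. H (\<omega> j) (\<omega> k)) = T \<omega> + ?d" .
      have "T \<omega> + ?d \<in> \<real>\<^sub>\<ge>\<^sub>0"
        using positive_definite_kernelD[OF pd, of n \<omega> "\<lambda>_. 1"] sp by (simp add: eq)
      moreover have "Re ?d \<le> of_nat n * C"
        using sum_bounded_above[of "{1..n}" "\<lambda>j. Re (H (\<omega> j) (\<omega> j))" C] diag sp by simp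
      moreover have "Im ?d = 0"
        using positive_definite_kernel_diag[OF pd] sp
        by (auto simp: complex_nonneg_Reals_iff intro!: sum.neutral)
      ultimately show ?case by (simp add: complex_nonneg_Reals_iff del: Re_sum Im_sum)
    qed
    then have re: "AE \<omega> in ?P. - (of_nat n * C) \<le> Re (T \<omega>)" and im: "AE \<omega> in ?P. Im (T \<omega>) = 0" by auto
    have "- (of_nat n * C) \<le> (LINT \<omega>|?P. Re (T \<omega>))"
      using integral_mono_AE[OF P.integrable_const integrable_Re[OF intT] re] by (simp add: P.prob_space)
    moreover have "(LINT \<omega>|?P. Im (T \<omega>)) = 0"
      using im by (rule integral_eq_zero_AE)
    ultimately show ?thesis
      using intT unfolding IT[symmetric] by simp
  qed
  \<comment> \<open>any \<open>n \<ge> 2\<close> shows that \<open>I\<close> is real, but only large \<open>n\<close> make the diagonal negligible\<close>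
  have "Im I = 0" using step[of 2] by simp
  moreover have "0 \<le> Re I"
  proof (rule ccontr)
    assume "\<not> 0 \<le> Re I"
    then obtain n :: nat where n: "C < of_nat n * (- Re I)"
      using reals_Archimedean3[of "- Re I"] by auto
    have "- (of_nat (Suc n) * C) \<le> of_nat (Suc n) * (of_nat n * Re I)"
      using step[of "Suc n"] by (simp add: algebra_simps)
    then have "of_nat (Suc n) * (- C) \<le> of_nat (Suc n) * (of_nat n * Re I)" by simp
    then have "- C \<le> of_nat n * Re I"
      by (subst (asm) mult_le_cancel_left_pos) simp_all
    with n show False by simp
  qed
  ultimately show ?thesis by (simp add: I_def complex_nonneg_Reals_iff)
qed (simp add: not_integrable_integral_eq)

text \<open>Normalising \<open>M\<close> to a probability measure \<open>N\<close> on \<open>B\<close> multiplies the double integral by the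
  positive number \<open>c\<^sup>2\<close>.\<close>

lemma double_integral_positive_definite_nonneg:
  assumes M: "sigma_finite_measure M"
    and B [measurable]: "B \<in> sets M" and B0: "0 < measure M B" 
    and pd: "positive_definite_kernel (space M) H"
    and supp: "\<And>x y. \<not> (x \<in> B \<and> y \<in> B) \<Longrightarrow> H x y = 0"
    and diag: "\<And>x. x \<in> space M \<Longrightarrow> Re (H x x) \<le> C"
    and G [measurable]: "G \<in> borel_measurable (M \<Otimes>\<^sub>M M)"
    and ae: "AE p in M \<Otimes>\<^sub>M M. G p = H (fst p) (snd p)"
  shows "(LINT p|(M \<Otimes>\<^sub>M M). G p) \<in> \<real>\<^sub>\<ge>\<^sub>0"
proof -
  define c where "c = 1 / measure M B"
  have c: "c > 0" using B0 by (simp add: c_def)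
  define N where "N = density M (\<lambda>x. ennreal (c * indicator B x))"
  have "emeasure N (space N) = (\<integral>\<^sup>+x. ennreal c * indicator B x \<partial>M)"
    by (simp add: N_def emeasure_density ennreal_mult' c less_imp_le ennreal_indicator[symmetric] cong: nn_integral_cong del: ennreal_indicator)
  also have "\<dots> = ennreal c * emeasure M B"
    by (simp add: nn_integral_cmult_indicator)
  also have "emeasure M B = ennreal (measure M B)"
    using B0 measure_zero_top[of M B] by (intro emeasure_eq_ennreal_measure) auto
  also have "ennreal c * \<dots> = 1" using c B0 by (simp add: ennreal_mult[symmetric] c_def)
  finally have N: "prob_space N" by (rule prob_spaceI)
  interpret N: prob_space N by fact
  have NN: "N \<Otimes>\<^sub>M N = density (M \<Otimes>\<^sub>M M) (\<lambda>p. ennreal (c\<^sup>2 * indicator (B \<times> B) p))"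
  proof -
    have "N \<Otimes>\<^sub>M N = density (M \<Otimes>\<^sub>M M) (\<lambda>(x, y). ennreal (c * indicator B x) * ennreal (c * indicator B y))"
      unfolding N_def
      by (rule pair_measure_density) (use M N.sigma_finite_measure_axioms in \<open>auto simp: N_def\<close>)
    also have "\<dots> = density (M \<Otimes>\<^sub>M M) (\<lambda>p. ennreal (c\<^sup>2 * indicator (B \<times> B) p))"
      using c by (intro arg_cong[where f = "density _"] ext)
        (auto simp: ennreal_mult[symmetric] power2_eq_square indicator_def)
    finally show ?thesis .
  qed
  have "(LINT p|(N \<Otimes>\<^sub>M N). G p) \<in> \<real>\<^sub>\<ge>\<^sub>0"
  proof (rule double_integral_positive_definite_nonneg_prob[OF N])
    show "positive_definite_kernel (space N) H" using pd by (simp add: N_def)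
    show "Re (H x x) \<le> C" if "x \<in> space N" for x using that diag by (simp add: N_def)
    show "G \<in> borel_measurable (N \<Otimes>\<^sub>M N)" unfolding NN by simp
    show "AE p in N \<Otimes>\<^sub>M N. G p = H (fst p) (snd p)"
      unfolding NN using ae by (subst AE_density) auto
  qed
  also have "(LINT p|(N \<Otimes>\<^sub>M N). G p) = (LINT p|(M \<Otimes>\<^sub>M M). (c\<^sup>2 * indicator (B \<times> B) p) *\<^sub>R G p)"
    unfolding NN using c by (subst integral_density) auto
  also have "\<dots> = (LINT p|(M \<Otimes>\<^sub>M M). c\<^sup>2 *\<^sub>R G p)"
  proof (rule integral_cong_AE)
    show "AE p in M \<Otimes>\<^sub>M M. (c\<^sup>2 * indicator (B \<times> B) p) *\<^sub>R G p = c\<^sup>2 *\<^sub>R G p"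
      using ae
    proof eventually_elim
      case (elim p)
      show ?case
      proof (cases "p \<in> B \<times> B")
        case False
        then have "H (fst p) (snd p) = 0" by (intro supp) (simp add: mem_Times_iff)
        with elim show ?thesis by simp
      qed simp
    qed
  qed measurable
  also have "\<dots> = c\<^sup>2 *\<^sub>R (LINT p|(M \<Otimes>\<^sub>M M). G p)" by simp
  finally show ?thesis
    using c by (simp add: complex_nonneg_Reals_iff zero_le_mult_iff)
qed


section \<open>Mean embeddings as integrals over the product\<close>

lemma lebesgue_measurable_ex_borel_complex:
  fixes f :: "'a::euclidean_space \<Rightarrow> complex"
  assumes [measurable]: "f \<in> borel_measurable lebesgue"
  obtains g where "g \<in> borel_measurable borel" "AE x in lborel. f x = g x"
proof -
  have "(\<lambda>x. Re (f x)) \<in> borel_measurable lebesgue" "(\<lambda>x. Im (f x)) \<in> borel_measurable lebesgue"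
    by measurable
  then obtain u v where [measurable]: "u \<in> borel_measurable borel" "v \<in> borel_measurable borel"
    and "AE x in lborel. Re (f x) = u x" "AE x in lborel. Im (f x) = v x"
    using completion_ex_borel_measurable_real[of "\<lambda>x. Re (f x)" lborel]
      completion_ex_borel_measurable_real[of "\<lambda>x. Im (f x)" lborel] by auto
  from this(3,4) have "AE x in lborel. f x = Complex (u x) (v x)"
    by eventually_elim (auto simp: complex_eq_iff)
  moreover have "(\<lambda>x. Complex (u x) (v x)) \<in> borel_measurable borel"
    unfolding Complex_eq by measurable
  ultimately show ?thesis using that by blast
qed

text \<open>Completeness of Lebesgue measure makes \<open>f\<close> measurable, so that the Borel function \<open>h\<close> can
  replace it.  This removes Lebesgue measurability from an iterated integral one variable at a time.\<close>

lemma lebesgue_integral_eq_lborel_AE: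
  fixes f h :: "'a::euclidean_space \<Rightarrow> complex"
  assumes h: "h \<in> borel_measurable borel" and ae: "AE x in lborel. f x = h x"
  shows "integral\<^sup>L lebesgue f = integral\<^sup>L lborel h"
proof -
  have h': "h \<in> borel_measurable lebesgue" using h by (simp add: measurable_completion)
  have ae': "AE x in lebesgue. h x = f x" using AE_completion[OF ae] by auto
  have "integral\<^sup>L lebesgue h = integral\<^sup>L lebesgue f"
    by (intro integral_cong_AE h' borel_measurable_AE[OF h' ae'] ae')
  with h show ?thesis by (simp add: integral_completion)
qed

lemma borel_measurable_cnj [measurable]: "cnj \<in> borel_measurable borel"
  by (intro borel_measurable_continuous_onI continuous_intros)

text \<open>A null set of the product has null sections over almost every point of the outer variable;
  so both the inner and the outer integrand may be changed to those of \<open>G\<close>, to which Fubini's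
  theorem applies.\<close>

lemma mean_embedding_inner_eq_integral_prod:
  fixes \<Omega> :: "'a::euclidean_space set"
  assumes G [measurable]: "G \<in> borel_measurable borel"
    and ae: "AE p in lborel. (if fst p \<in> \<Omega> \<and> snd p \<in> \<Omega> then K (fst p) (snd p) else 0) = G p"
    and [measurable]: "\<phi> \<in> borel_measurable borel" "\<psi> \<in> borel_measurable borel"
    and int: "integrable lborel (\<lambda>p. G p * \<phi> (fst p) * cnj (\<psi> (snd p)))"
  shows "mean_embedding_inner \<Omega> K \<phi> \<psi> = (LINT p|lborel. G p * \<phi> (fst p) * cnj (\<psi> (snd p)))"
proof -
  let ?h = "\<lambda>x y. G (x, y) * \<phi> x * cnj (\<psi> y)"
  have [measurable]: "G \<in> borel_measurable (borel \<Otimes>\<^sub>M borel)" by (simp add: borel_prod)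
  define K0 where "K0 x y = (if x \<in> \<Omega> \<and> y \<in> \<Omega> then K x y else 0)" for x y
  have "AE p in lborel \<Otimes>\<^sub>M lborel. K0 (fst p) (snd p) = G p"
    using ae unfolding lborel_prod K0_def .
  \<comment> \<open>the outer integral is over the second variable, whereas \<open>AE_pair\<close> takes the first as the outer one\<close>
  then have "AE p in distr (lborel \<Otimes>\<^sub>M lborel) (lborel \<Otimes>\<^sub>M lborel) (\<lambda>(x, y). (y, x)).
      K0 (fst p) (snd p) = G p"
    by (subst lborel_pair.distr_pair_swap[symmetric])
  from AE_distrD[OF _ this]
  have "AE p in lborel \<Otimes>\<^sub>M lborel. K0 (snd p) (fst p) = G (snd p, fst p)"
    by (simp add: case_prod_unfold)
  from lborel_pair.AE_pair[OF this]
  have ae2: "AE y in lborel. AE x in lborel. K0 x y = G (x, y)"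
    by simp
  have "mean_embedding_inner \<Omega> K \<phi> \<psi> = (LINT y|lborel. LINT x|lborel. ?h x y)"
    unfolding mean_embedding_inner_def set_lebesgue_integral_def
  proof (rule lebesgue_integral_eq_lborel_AE)
    show "(\<lambda>y. LINT x|lborel. ?h x y) \<in> borel_measurable borel" by measurable
    show "AE y in lborel. indicator \<Omega> y *\<^sub>R (LINT x|lebesgue. indicator \<Omega> x *\<^sub>R (K x y * \<phi> x * cnj (\<psi> y)))
        = (LINT x|lborel. ?h x y)"
      using ae2
    proof eventually_elim
      case (elim y)
      have "indicator \<Omega> y *\<^sub>R (LINT x|lebesgue. indicator \<Omega> x *\<^sub>R (K x y * \<phi> x * cnj (\<psi> y)))
         = (LINT x|lebesgue. indicator \<Omega> y *\<^sub>R indicator \<Omega> x *\<^sub>R (K x y * \<phi> x * cnj (\<psi> y)))"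
        by (cases "y \<in> \<Omega>") simp_all
      also have "\<dots> = (LINT x|lborel. ?h x y)"
      proof (rule lebesgue_integral_eq_lborel_AE)
        show "AE x in lborel. indicator \<Omega> y *\<^sub>R indicator \<Omega> x *\<^sub>R (K x y * \<phi> x * cnj (\<psi> y)) = ?h x y"
          using elim by eventually_elim (auto simp: indicator_def K0_def split: if_splits)
      qed measurable
      finally show ?case .
    qed
  qed
  also have "\<dots> = (LINT p|(lborel \<Otimes>\<^sub>M lborel). G p * \<phi> (fst p) * cnj (\<psi> (snd p)))"
    using lborel_pair.integral_snd[of ?h] int by (simp add: lborel_prod case_prod_unfold)
  finally show ?thesis by (simp add: lborel_prod)
qed

section \<open>Test functions\<close>

text \<open>The function is continuous on \<open>\<Omega>\<close> and zero on the complement of its support; these two open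
  sets cover the space.\<close>

lemma test_function_continuous:
  assumes "open \<Omega>" "\<phi> \<in> test_functions \<Omega>"
  shows "continuous_on UNIV \<phi>"
proof -
  let ?Z = "closure {x. \<phi> x \<noteq> 0}"
  have "Ck_on 0 \<Omega> \<phi>" and sub: "?Z \<subseteq> \<Omega>"
    using assms(2) unfolding test_functions_def smooth_on_def by blast+
  then have "continuous_on \<Omega> \<phi>" by simp
  moreover have "continuous_on (- ?Z) \<phi>"
    using closure_subset[of "{x. \<phi> x \<noteq> 0}"] by (subst continuous_on_cong[OF refl, of _ _ "\<lambda>_. 0"]) auto
  ultimately have "continuous_on (\<Omega> \<union> - ?Z) \<phi>"
    using assms(1) by (intro continuous_on_open_Un) auto
  moreover have "\<Omega> \<union> - ?Z = UNIV" using sub by auto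
  ultimately show ?thesis by simp
qed

text \<open>One number \<open>B\<close> serves both as a bound of the values and as a radius of the support.\<close>

lemma test_function_bounds:
  assumes "open \<Omega>" "\<phi> \<in> test_functions \<Omega>"
  obtains B where "\<And>x. norm (\<phi> x) \<le> B" "\<And>x. norm x > B \<Longrightarrow> \<phi> x = 0"
proof -
  let ?Z = "closure {x. \<phi> x \<noteq> 0}"
  have Z: "compact ?Z" using assms(2) by (simp add: test_functions_def)
  have zero: "\<phi> x = 0" if "x \<notin> ?Z" for x
    using that closure_subset[of "{x. \<phi> x \<noteq> 0}"] by auto
  have "bounded (\<phi> ` ?Z)"
    using compact_continuous_image[OF continuous_on_subset[OF test_function_continuous[OF assms]] Z]
    by (simp add: compact_imp_bounded)
  then obtain b where b: "b > 0" "\<And>x. x \<in> ?Z \<Longrightarrow> norm (\<phi> x) \<le> b"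
    by (auto simp: bounded_pos)
  obtain r where r: "\<And>x. x \<in> ?Z \<Longrightarrow> norm x \<le> r"
    using compact_imp_bounded[OF Z] by (auto simp: bounded_iff)
  show ?thesis
  proof (rule that[of "max b r"])
    show "norm (\<phi> x) \<le> max b r" for x
      using b zero[of x] by (cases "x \<in> ?Z") (auto simp: le_max_iff_disj)
    show "\<phi> x = 0" if "norm x > max b r" for x
      using that r[of x] zero[of x] by (cases "x \<in> ?Z") auto
  qed
qed

section \<open>The kernel on test functions\<close>

theorem theorem1:
  fixes \<Omega> :: "(real ^ 'd) set"
    and K :: "real ^ 'd \<Rightarrow> real ^ 'd \<Rightarrow> complex"
  assumes "open \<Omega>"
    and "measurable_kernel \<Omega> K"
    and "translation_invariant_kernel \<Omega> K"
    and "positive_definite_kernel \<Omega> K"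
  shows "positive_definite_kernel (test_functions \<Omega>) (mean_embedding_inner \<Omega> K)"
proof -
  note op = assms(1) and pd = assms(4)
  define K0 where "K0 x y = (if x \<in> \<Omega> \<and> y \<in> \<Omega> then K x y else 0)" for x y
  obtain F where F: "\<And>x y. x \<in> \<Omega> \<Longrightarrow> y \<in> \<Omega> \<Longrightarrow> K x y = F (x - y)"
    using assms(3) unfolding translation_invariant_kernel_def by blast
  \<comment> \<open>for empty \<open>\<Omega>\<close> the number \<open>F 0\<close> is arbitrary, hence the maximum with \<open>0\<close>\<close>
  define C where "C = max 0 (Re (F 0))"
  have diag: "Re (K x x) \<le> C" if "x \<in> \<Omega>" for x
    using F[OF that that] by (simp add: C_def)
  have pd0: "positive_definite_kernel UNIV K0"
    using positive_definite_kernel_zero_extension[OF pd] by (simp add: K0_def[abs_def])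
  have diag0: "Re (K0 x x) \<le> C" for x
    using diag by (auto simp: K0_def C_def)
  have K0_le: "norm (K0 x y) \<le> C" for x y
    using positive_definite_kernel_norm_le[OF pd0, of x y] diag0[of x] diag0[of y] by simp
  have "(\<lambda>p. if p \<in> \<Omega> \<times> \<Omega> then (\<lambda>(x, y). K x y) p else 0) \<in> borel_measurable lebesgue"
  proof (rule borel_measurable_if_I)
    show "(\<lambda>(x, y). K x y) \<in> borel_measurable (lebesgue_on (\<Omega> \<times> \<Omega>))"
      using assms(2) by (simp add: measurable_kernel_def)
    show "\<Omega> \<times> \<Omega> \<in> sets lebesgue"
      using open_Times[OF op op] by (intro sets_completionI_sets) (simp add: borel_open)
  qed
  then obtain G where G: "G \<in> borel_measurable borel"
    and aeG: "AE p in lborel. (if p \<in> \<Omega> \<times> \<Omega> then (\<lambda>(x, y). K x y) p else 0) = G p"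
    by (rule lebesgue_measurable_ex_borel_complex)
  from aeG have aeG': "AE p in lborel. (if fst p \<in> \<Omega> \<and> snd p \<in> \<Omega> then K (fst p) (snd p) else 0) = G p"
    unfolding case_prod_unfold mem_Times_iff .
  have [measurable]: "G \<in> borel_measurable (borel \<Otimes>\<^sub>M borel)"
    using G by (simp add: borel_prod)
  have aeG0: "AE p in lborel. G p = K0 (fst p) (snd p)"
    using aeG' by eventually_elim (simp add: K0_def)
  have meas: "\<phi> \<in> borel_measurable borel" if "\<phi> \<in> test_functions \<Omega>" for \<phi>
    using test_function_continuous[OF op that] by (rule borel_measurable_continuous_onI)
  have int: "integrable lborel (\<lambda>p. G p * \<phi> (fst p) * cnj (\<psi> (snd p)))"
    if \<phi>: "\<phi> \<in> test_functions \<Omega>" and \<psi>: "\<psi> \<in> test_functions \<Omega>" for \<phi> \<psi>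
  proof -
    note [measurable] = meas[OF \<phi>] meas[OF \<psi>]
    obtain a where a: "\<And>x. norm (\<phi> x) \<le> a" "\<And>x. norm x > a \<Longrightarrow> \<phi> x = 0"
      using test_function_bounds[OF op \<phi>] by metis
    obtain b where b: "\<And>x. norm (\<psi> x) \<le> b" "\<And>x. norm x > b \<Longrightarrow> \<psi> x = 0"
      using test_function_bounds[OF op \<psi>] by metis
    have a0: "0 \<le> a" using norm_ge_zero a(1) order_trans by blast
    show ?thesis
    proof (rule integrableI_bounded_set)
      show "cball 0 (a + b) \<in> sets lborel" by simp
      show "(\<lambda>p. G p * \<phi> (fst p) * cnj (\<psi> (snd p))) \<in> borel_measurable lborel"
        unfolding lborel_prod[symmetric] by measurable
      show "emeasure lborel (cball 0 (a + b) :: ((real^'d) \<times> (real^'d)) set) < \<infinity>"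
        by (rule emeasure_lborel_cball_finite)
      show "AE p in lborel. p \<in> cball 0 (a + b) \<longrightarrow> norm (G p * \<phi> (fst p) * cnj (\<psi> (snd p))) \<le> C * a * b"
        using aeG0
      proof eventually_elim
        case (elim p)
        show ?case
          using K0_le a b a0 by (auto simp: norm_mult elim C_def intro!: mult_mono)
      qed
      show "AE p in lborel. p \<notin> cball 0 (a + b) \<longrightarrow> G p * \<phi> (fst p) * cnj (\<psi> (snd p)) = 0"
      proof (intro AE_I2 impI)
        fix p :: "(real^'d) \<times> (real^'d)" assume "p \<notin> cball 0 (a + b)"
        then have "a < norm (fst p) \<or> b < norm (snd p)"
          using norm_Pair_le[of "fst p" "snd p"] by auto
        then show "G p * \<phi> (fst p) * cnj (\<psi> (snd p)) = 0" using a(2) b(2) by auto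
      qed
    qed
  qed
  show ?thesis
    unfolding positive_definite_kernel_def
  proof (intro allI impI)
    fix m :: nat and s c
    assume s: "\<forall>j\<in>{1..m}. s j \<in> test_functions \<Omega>"
    define \<Phi> where "\<Phi> x = (\<Sum>j=1..m. c j * s j x)" for x
    have [measurable]: "\<Phi> \<in> borel_measurable borel"
      unfolding \<Phi>_def using s meas by (intro borel_measurable_sum borel_measurable_times) auto
    have "\<forall>j\<in>{1..m}. \<exists>B. (\<forall>x. norm (s j x) \<le> B) \<and> (\<forall>x. norm x > B \<longrightarrow> s j x = 0)"
      using s test_function_bounds[OF op] by metis
    then obtain b where b: "\<And>j x. j \<in> {1..m} \<Longrightarrow> norm (s j x) \<le> b j"
      "\<And>j x. j \<in> {1..m} \<Longrightarrow> norm x > b j \<Longrightarrow> s j x = 0"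
      by metis
    have b0: "0 \<le> b j" if "j \<in> {1..m}" for j
      using b(1)[OF that] norm_ge_zero order_trans by blast
    \<comment> \<open>the summand \<open>1\<close> keeps the ball of positive measure when all test functions vanish\<close>
    define R where "R = 1 + (\<Sum>j=1..m. b j)"
    have R: "0 < R" using b0 by (auto simp: R_def intro!: add_pos_nonneg sum_nonneg)
    have \<Phi>0: "\<Phi> x = 0" if "x \<notin> ball 0 R" for x
    proof -
      have "s j x = 0" if j: "j \<in> {1..m}" for j
      proof -
        have "b j \<le> (\<Sum>j=1..m. b j)" using j b0 by (intro member_le_sum) auto
        then show ?thesis using \<open>x \<notin> ball 0 R\<close> by (intro b(2) j) (auto simp: R_def)
      qed
      then show ?thesis by (simp add: \<Phi>_def)
    qed
    define A where "A = (\<Sum>j=1..m. norm (c j) * b j)"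
    have \<Phi>_le: "norm (\<Phi> x) \<le> A" for x
      unfolding \<Phi>_def A_def using b(1)
      by (intro order_trans[OF norm_sum] sum_mono) (auto simp: norm_mult intro!: mult_left_mono)
    define f where "f j k p = c j * cnj (c k) * (G p * s j (fst p) * cnj (s k (snd p)))" for j k p
    have f_int: "integrable lborel (f j k)" if "j \<in> {1..m}" "k \<in> {1..m}" for j k
      unfolding f_def[abs_def] using int s that by (intro integrable_mult_right) blast
    have "(\<Sum>j=1..m. \<Sum>k=1..m. c j * cnj (c k) * mean_embedding_inner \<Omega> K (s j) (s k))
      = (\<Sum>j=1..m. \<Sum>k=1..m. c j * cnj (c k) * (LINT p|lborel. G p * s j (fst p) * cnj (s k (snd p))))"
      using s meas int by (intro sum.cong refl arg_cong2[where f = "(*)"]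
          mean_embedding_inner_eq_integral_prod[OF G aeG']) auto
    also have "\<dots> = (\<Sum>j=1..m. \<Sum>k=1..m. (LINT p|lborel. f j k p))"
      by (simp add: f_def)
    also have "\<dots> = (\<Sum>j=1..m. (LINT p|lborel. (\<Sum>k=1..m. f j k p)))"
      by (intro sum.cong refl Bochner_Integration.integral_sum[symmetric] f_int)
    also have "\<dots> = (LINT p|lborel. (\<Sum>j=1..m. \<Sum>k=1..m. f j k p))"
      by (intro Bochner_Integration.integral_sum[symmetric] Bochner_Integration.integrable_sum f_int)
    also have "\<dots> = (LINT p|lborel. G p * \<Phi> (fst p) * cnj (\<Phi> (snd p)))"
      by (intro Bochner_Integration.integral_cong refl)
        (simp add: f_def \<Phi>_def cnj_sum sum_product sum_distrib_left mult_ac)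
    also have "\<dots> = (LINT p|(lborel \<Otimes>\<^sub>M lborel). G p * \<Phi> (fst p) * cnj (\<Phi> (snd p)))"
      by (simp add: lborel_prod)
    also have "\<dots> \<in> \<real>\<^sub>\<ge>\<^sub>0"
    proof (rule double_integral_positive_definite_nonneg[where B = "ball 0 R" and C = "A\<^sup>2 * C"
          and H = "\<lambda>x y. \<Phi> x * cnj (\<Phi> y) * K0 x y"])
      show "sigma_finite_measure (lborel :: (real^'d) measure)" by (rule lborel.sigma_finite_measure_axioms)
      show "0 < measure lborel (ball (0::real^'d) R)" using R by (rule content_ball_pos)
      show "positive_definite_kernel (space lborel) (\<lambda>x y. \<Phi> x * cnj (\<Phi> y) * K0 x y)"
        using positive_definite_kernel_weighted[OF pd0] by simp
      show "Re (\<Phi> x * cnj (\<Phi> x) * K0 x x) \<le> A\<^sup>2 * C" for x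
      proof -
        have "norm (\<Phi> x * cnj (\<Phi> x) * K0 x x) \<le> A * A * C"
          unfolding norm_mult using \<Phi>_le[of x] K0_le[of x x] order_trans[OF norm_ge_zero \<Phi>_le[of x]]
          by (intro mult_mono) auto
        then show ?thesis using complex_Re_le_cmod order_trans by (fastforce simp: power2_eq_square)
      qed
      show "(\<lambda>p. G p * \<Phi> (fst p) * cnj (\<Phi> (snd p))) \<in> borel_measurable (lborel \<Otimes>\<^sub>M lborel)"
        by measurable
      show "AE p in lborel \<Otimes>\<^sub>M lborel. G p * \<Phi> (fst p) * cnj (\<Phi> (snd p))
          = \<Phi> (fst p) * cnj (\<Phi> (snd p)) * K0 (fst p) (snd p)"
        unfolding lborel_prod using aeG0 by eventually_elim simp
    qed (auto simp: \<Phi>0)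
    finally show "(\<Sum>j=1..m. \<Sum>k=1..m. c j * cnj (c k) * mean_embedding_inner \<Omega> K (s j) (s k)) \<in> \<real>\<^sub>\<ge>\<^sub>0" .
  qed
qed

end
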